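(* Let $(X,T)$ be a flow. Then $(X,T)$ can be equivariantly embedded in $L(\mathbb{R})$ if and only if $\mathrm{Fix}(X,T)$ can be topologically embedded in the unit interval $[0,1]$.
   Context: A flow $(X,T)$ is a compact metric space $X$ together with a continuous action $T:\mathbb{R}\times X\to X$, $(t,x)\mapsto T_t x$, of the additive group $\mathbb{R}$. $\mathrm{Fix}(X,T)$ is the set of $x\in X$ with $T_t x=x$ for all $t\in\mathbb{R}$, with the subspace topology. $L(\mathbb{R})$ is the set of maps $\varphi:\mathbb{R}\to[0,1]$ satisfying $|\varphi(s)-\varphi(t)|\leq |s-t|$ for all $s,t\in\mathbb{R}$, endowed with the topology of uniform convergence over compact subsets of $\mathbb{R}$, given by the distance $\sum_{n=1}^\infty 2^{-n}\max_{|t|\leq n}|\varphi(t)-\psi(t)|$. The group $\mathbb{R}$ acts continuously on $L(\mathbb{R})$ by translation: $s\in\mathbb{R}$ sends $\varphi$ to the function $t\mapsto\varphi(t+s)$. "$(X,T)$ can be equivariantly embedded in $L(\mathbb{R})$" means that there is a continuous map $f:X\to L(\mathbb{R})$ which is $\mathbb{R}$-equivariant (i.e. $f(T_s x)(t)=f(x)(t+s)$ for all $x\in X$, $s,t\in\mathbb{R}$) and a topological embedding (a homeomorphism onto its image). *)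

theory Defs
  imports "HOL-Analysis.Analysis"
begin

locale flow =
  fixes X :: "'a::metric_space set" and T :: "real \<Rightarrow> 'a \<Rightarrow> 'a"
  assumes compact_space: "compact X"
    and maps_to: "T t \<in> X \<rightarrow> X"
    and action_zero: "x \<in> X \<Longrightarrow> T 0 x = x"
    and action_add: "x \<in> X \<Longrightarrow> T (s + t) x = T s (T t x)"
    and continuous_action: "continuous_on (UNIV \<times> X) (\<lambda>(t, x). T t x)"

definition Fix :: "'a set \<Rightarrow> (real \<Rightarrow> 'a \<Rightarrow> 'a) \<Rightarrow> 'a set" where
  "Fix X T = {x \<in> X. \<forall>t. T t x = x}"

typedef LR = "{\<phi> :: real \<Rightarrow> real. range \<phi> \<subseteq> {0..1} \<and> (\<forall>s t. \<bar>\<phi> s - \<phi> t\<bar> \<le> \<bar>s - t\<bar>)}"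
  morphisms LR_apply LR_of
  by (rule exI[of _ "\<lambda>_. 0"]) auto

lemma LR_apply_bounds: "0 \<le> LR_apply \<phi> t" "LR_apply \<phi> t \<le> 1"
proof -
  have "range (LR_apply \<phi>) \<subseteq> {0..1}" using LR_apply[of \<phi>] by simp
  then have "LR_apply \<phi> t \<in> {0..1}" by blast
  then show "0 \<le> LR_apply \<phi> t" "LR_apply \<phi> t \<le> 1" by auto
qed

text \<open>The supremum below is a maximum, as the elements of \<open>LR\<close> are continuous.\<close>

definition LR_maxdist :: "nat \<Rightarrow> LR \<Rightarrow> LR \<Rightarrow> real" where
  "LR_maxdist n \<phi> \<psi> = (SUP t\<in>{- real n..real n}. \<bar>LR_apply \<phi> t - LR_apply \<psi> t\<bar>)"

lemma LR_maxdist_upper: "\<bar>t\<bar> \<le> real n \<Longrightarrow> \<bar>LR_apply \<phi> t - LR_apply \<psi> t\<bar> \<le> LR_maxdist n \<phi> \<psi>"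
  unfolding LR_maxdist_def
proof (rule cSUP_upper)
  have "\<bar>LR_apply \<phi> t - LR_apply \<psi> t\<bar> \<le> 1" for t
    using LR_apply_bounds[of \<phi> t] LR_apply_bounds[of \<psi> t] by linarith
  then show "bdd_above ((\<lambda>t. \<bar>LR_apply \<phi> t - LR_apply \<psi> t\<bar>) ` {- real n..real n})"
    by (rule bdd_aboveI2)
qed auto

lemma LR_maxdist_least:
  "(\<And>t. \<bar>t\<bar> \<le> real n \<Longrightarrow> \<bar>LR_apply \<phi> t - LR_apply \<psi> t\<bar> \<le> c) \<Longrightarrow> LR_maxdist n \<phi> \<psi> \<le> c"
  unfolding LR_maxdist_def by (rule cSUP_least) auto

lemma LR_maxdist_nonneg: "0 \<le> LR_maxdist n \<phi> \<psi>"
  using LR_maxdist_upper[of 0 n \<phi> \<psi>] by simp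

lemma LR_maxdist_le_1: "LR_maxdist n \<phi> \<psi> \<le> 1"
proof (rule LR_maxdist_least)
  show "\<bar>LR_apply \<phi> t - LR_apply \<psi> t\<bar> \<le> 1" for t
    using LR_apply_bounds[of \<phi> t] LR_apply_bounds[of \<psi> t] by linarith
qed

lemma LR_maxdist_triangle: "LR_maxdist n \<phi> \<psi> \<le> LR_maxdist n \<phi> \<theta> + LR_maxdist n \<psi> \<theta>"
proof (rule LR_maxdist_least)
  show "\<bar>LR_apply \<phi> t - LR_apply \<psi> t\<bar> \<le> LR_maxdist n \<phi> \<theta> + LR_maxdist n \<psi> \<theta>"
    if "\<bar>t\<bar> \<le> real n" for t
    using LR_maxdist_upper[OF that, of \<phi> \<theta>] LR_maxdist_upper[OF that, of \<psi> \<theta>] by linarith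
qed

lemma LR_dist_summable: "summable (\<lambda>n. (1/2) ^ Suc n * LR_maxdist (Suc n) \<phi> \<psi>)"
proof (rule summable_comparison_test')
  show "summable (\<lambda>n. (1/2::real) ^ Suc n)"
    by (subst summable_Suc_iff) (simp add: summable_geometric)
  show "norm ((1/2) ^ Suc n * LR_maxdist (Suc n) \<phi> \<psi>) \<le> (1/2) ^ Suc n" for n
    using mult_left_mono[OF LR_maxdist_le_1, of "(1/2) ^ Suc n" "Suc n" \<phi> \<psi>]
    by (simp add: LR_maxdist_nonneg)
qed

instantiation LR :: metric_space
begin

text \<open>The index is shifted so that the weights start with \<open>2\<^sup>-\<^sup>1\<close>.\<close>

definition dist_LR :: "LR \<Rightarrow> LR \<Rightarrow> real" where
  "dist_LR \<phi> \<psi> = (\<Sum>n. (1/2) ^ Suc n * LR_maxdist (Suc n) \<phi> \<psi>)"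

definition uniformity_LR :: "(LR \<times> LR) filter" where
  "uniformity_LR = (INF e\<in>{0<..}. principal {(\<phi>, \<psi>). dist \<phi> \<psi> < e})"

definition open_LR :: "LR set \<Rightarrow> bool" where
  "open_LR U \<longleftrightarrow> (\<forall>\<phi>\<in>U. eventually (\<lambda>(\<phi>', \<psi>). \<phi>' = \<phi> \<longrightarrow> \<psi> \<in> U) uniformity)"

instance
proof
  fix \<phi> \<psi> \<theta> :: LR
  show "(dist \<phi> \<psi> = 0) = (\<phi> = \<psi>)"
  proof
    assume "dist \<phi> \<psi> = 0"
    then have zero: "LR_maxdist (Suc n) \<phi> \<psi> = 0" for n
      using suminf_eq_zero_iff[OF LR_dist_summable[of \<phi> \<psi>]]
      by (auto simp: dist_LR_def LR_maxdist_nonneg)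
    have "LR_apply \<phi> t = LR_apply \<psi> t" for t
    proof -
      obtain n where "\<bar>t\<bar> \<le> real n" using real_arch_simple by blast
      then have "\<bar>t\<bar> \<le> real (Suc n)" by simp
      from LR_maxdist_upper[OF this, of \<phi> \<psi>] zero[of n] show ?thesis by simp
    qed
    then show "\<phi> = \<psi>" by (metis LR_apply_inject ext)
  next
    assume "\<phi> = \<psi>"
    then have "LR_maxdist n \<phi> \<psi> = 0" for n
      by (intro antisym LR_maxdist_nonneg LR_maxdist_least) simp
    then show "dist \<phi> \<psi> = 0" by (simp add: dist_LR_def)
  qed
  show "dist \<phi> \<psi> \<le> dist \<phi> \<theta> + dist \<psi> \<theta>"
    unfolding dist_LR_def suminf_add[OF LR_dist_summable LR_dist_summable]
  proof (rule suminf_le)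
    show "(1/2) ^ Suc n * LR_maxdist (Suc n) \<phi> \<psi>
        \<le> (1/2) ^ Suc n * LR_maxdist (Suc n) \<phi> \<theta> + (1/2) ^ Suc n * LR_maxdist (Suc n) \<psi> \<theta>" for n
      unfolding distrib_left[symmetric] by (rule mult_left_mono[OF LR_maxdist_triangle]) simp
  qed (intro LR_dist_summable summable_add)+
qed (simp_all add: uniformity_LR_def open_LR_def)

end

definition LR_translate :: "real \<Rightarrow> LR \<Rightarrow> LR" where
  "LR_translate s \<phi> = LR_of (\<lambda>t. LR_apply \<phi> (t + s))"

lemma LR_apply_translate: "LR_apply (LR_translate s \<phi>) t = LR_apply \<phi> (t + s)"
proof -
  have "\<bar>LR_apply \<phi> (u + s) - LR_apply \<phi> (v + s)\<bar> \<le> \<bar>(u + s) - (v + s)\<bar>" for u v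
    using LR_apply[of \<phi>] by blast
  then show ?thesis
    unfolding LR_translate_def by (subst LR_of_inverse) (auto simp: LR_apply_bounds)
qed

definition equivariantly_embeds_in_LR :: "'a::metric_space set \<Rightarrow> (real \<Rightarrow> 'a \<Rightarrow> 'a) \<Rightarrow> bool" where
  "equivariantly_embeds_in_LR X T \<longleftrightarrow>
     (\<exists>f :: 'a \<Rightarrow> LR. embedding_map (top_of_set X) euclidean f \<and>
        (\<forall>x\<in>X. \<forall>s. f (T s x) = LR_translate s (f x)))"

end

theory Submission
  imports Defs "HOL-Library.Landau_Symbols"
begin

text \<open>For an embedding \<open>f\<close>, evaluating \<open>f x\<close> at \<open>0\<close> embeds the fixed points, whose images are
  constant functions.

  For the converse, let \<open>A g\<close> be the integral of \<open>exp (-s) g(T s x)\<close> over \<open>0 \<le> s \<le> 1\<close>. If \<open>g\<close> has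
  values in \<open>[0, 1]\<close>, then so has \<open>A g\<close>, it is \<open>1\<close>-Lipschitz along orbits, and its values along an
  orbit determine those of \<open>g\<close>. Hence it is enough to find a continuous \<open>f : X \<rightarrow> [0, 1]\<close>, without
  any Lipschitz condition, whose values along the orbits separate the points of \<open>X\<close>.

  Take \<open>f\<close> to be \<open>A H + \<Sum>\<^sub>k 2\<^sup>-\<^sup>k A b \<bar>A (A g\<^sub>k) - q\<^sub>k\<bar>\<^bsup>a\<^sub>k\<^esup>\<close> up to scaling. Here \<open>H\<close> is injective on the fixed
  points, \<open>b\<close> vanishes exactly there, the pairs \<open>(g\<^sub>k, q\<^sub>k)\<close> run through a separating sequence of
  functions combined with all rational levels, and the exponents \<open>a\<^sub>k\<close> in \<open>[1/2, 1)\<close> increase.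
  As the exponents differ, the singularities of \<open>f\<close> along an orbit reveal, for each \<open>k\<close>, when
  \<open>A (A g\<^sub>k)\<close> crosses the level \<open>q\<^sub>k\<close> with nonzero speed. If \<open>f\<close> agrees along the orbits of \<open>x\<close> and
  \<open>y\<close>, not both fixed, then each \<open>A (A g)\<close> therefore agrees along both orbits or is constant along
  them, and so does \<open>g\<close>; a \<open>g\<close> that distinguishes \<open>x\<close> from \<open>y\<close> and from another point of its orbit
  shows \<open>x = y\<close>.\<close>

section \<open>Power singularities\<close>

text \<open>After division by \<open>(x + y) powr a\<close> this is \<open>z \<le> z powr a\<close>
  on [0, 1], applied to two fractions with sum 1.\<close>

lemma powr_subadditive:
  fixes x y a :: real
  assumes "0 \<le> x" "0 \<le> y" "0 < a" "a \<le> 1"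
  shows "(x + y) powr a \<le> x powr a + y powr a"
proof (cases "x + y = 0")
  case True
  then show ?thesis using assms by simp
next
  case False
  with assms have pos: "x + y > 0" by linarith
  have le: "z / (x + y) \<le> (z / (x + y)) powr a" if "0 \<le> z" "z \<le> x + y" for z
  proof (cases "z = 0")
    case False
    then have "(z / (x + y)) powr 1 \<le> (z / (x + y)) powr a"
      using that pos assms by (intro powr_mono') auto
    then show ?thesis using that pos by simp
  qed simp
  have "1 = x / (x + y) + y / (x + y)"
    using pos by (simp add: add_divide_distrib [symmetric])
  also have "\<dots> \<le> (x / (x + y)) powr a + (y / (x + y)) powr a"
    using assms by (intro add_mono le) auto
  also have "\<dots> = (x powr a + y powr a) / (x + y) powr a"
    using assms pos by (simp add: powr_divide add_divide_distrib)
  finally show ?thesis using pos by (simp add: field_simps)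
qed

lemma abs_powr_diff_le:
  fixes x y a :: real
  assumes "0 < a" "a \<le> 1"
  shows "\<bar>\<bar>x\<bar> powr a - \<bar>y\<bar> powr a\<bar> \<le> \<bar>x - y\<bar> powr a"
proof -
  have "\<bar>x\<bar> powr a \<le> \<bar>y\<bar> powr a + \<bar>x - y\<bar> powr a" for x y :: real
  proof -
    have "\<bar>x\<bar> powr a \<le> (\<bar>y\<bar> + \<bar>x - y\<bar>) powr a"
      using assms by (intro powr_mono2) auto
    also have "\<dots> \<le> \<bar>y\<bar> powr a + \<bar>x - y\<bar> powr a"
      using assms by (intro powr_subadditive) auto
    finally show ?thesis .
  qed
  from this[of x y] this[of y x] show ?thesis
    by (simp add: abs_minus_commute abs_le_iff)
qed

lemma powr_bigo_at_right_0:
  fixes a b :: real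
  assumes "a \<le> b"
  shows "(\<lambda>d. d powr b) \<in> O[at_right 0](\<lambda>d. d powr a)"
proof (rule landau_o.big_mono)
  have "\<forall>\<^sub>F d in at_right (0::real). d \<in> {0<..<1}"
    by (rule eventually_at_right_real) simp
  then show "\<forall>\<^sub>F d in at_right 0. norm (d powr b) \<le> norm (d powr a)"
    by eventually_elim (use assms in \<open>auto intro: powr_mono'\<close>)
qed

lemma ident_bigo_powr_at_right_0:
  fixes a :: real
  assumes "a \<le> 1"
  shows "(\<lambda>d. d) \<in> O[at_right 0](\<lambda>d. d powr a)"
proof -
  have "(\<lambda>d::real. d) \<in> \<Theta>[at_right 0](\<lambda>d. d powr 1)"
    by (intro bigthetaI_cong eventually_mono[OF eventually_at_right_less]) auto
  with powr_bigo_at_right_0[OF assms] show ?thesis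
    using landau_o.big.cong_bigtheta landau_o.big_trans bigthetaD1 by blast
qed

lemma DERIV_imp_bigo_at_right:
  fixes u :: "real \<Rightarrow> real"
  assumes "(u has_real_derivative l) (at 0)"
  shows "(\<lambda>d. u d - u 0) \<in> O[at_right 0](\<lambda>d. d)"
proof (rule bigoI_tendsto[where c = l])
  show "((\<lambda>d. (u d - u 0) / d) \<longlongrightarrow> l) (at_right 0)"
    using DERIV_D[OF assms] by (simp add: filterlim_at_split)
  show "\<forall>\<^sub>F d in at_right (0::real). d \<noteq> 0"
    by (rule eventually_mono[OF eventually_at_right_less]) auto
qed

text \<open>If \<open>v 0 \<noteq> 0\<close>, then \<open>\<bar>v d\<bar> powr a\<close> is
  differentiable at 0 and its increment is O(d). If \<open>v 0 = 0\<close>, the mean value theorem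
  and the Lipschitz bound on \<open>v'\<close> give
  \<open>\<bar>v d - v' 0 * d\<bar> \<le> C * d\<^sup>2\<close>; replacing \<open>v d\<close> by
  \<open>v' 0 * d\<close> thus costs O(\<open>d powr (2 * a)\<close>), which is O(d) because
  \<open>1 / 2 \<le> a\<close>.\<close>

lemma powr_singularity_expansion:
  fixes \<beta> v v' :: "real \<Rightarrow> real" and a C :: real
  assumes \<beta>: "(\<beta> has_real_derivative b) (at 0)"
    and v: "\<And>t. (v has_real_derivative v' t) (at t)"
    and v': "\<And>t. \<bar>v' t - v' 0\<bar> \<le> C * \<bar>t\<bar>"
    and a: "1 / 2 \<le> a" "a \<le> 1"
  shows "(\<lambda>d. \<beta> d * \<bar>v d\<bar> powr a - \<beta> 0 * \<bar>v 0\<bar> powr a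
            - (if v 0 = 0 then \<beta> 0 * \<bar>v' 0\<bar> powr a else 0) * d powr a) \<in> O[at_right 0](\<lambda>d. d)"
proof -
  have vcont: "continuous (at 0) v" by (rule DERIV_continuous[OF v])
  have "((\<lambda>d. \<bar>v d\<bar> powr a) \<longlongrightarrow> \<bar>v 0\<bar> powr a) (at_right 0)"
    using vcont a unfolding continuous_at filterlim_at_split
    by (intro tendsto_powr' tendsto_rabs tendsto_const) auto
  then have bdd: "(\<lambda>d. \<bar>v d\<bar> powr a) \<in> O[at_right 0](\<lambda>_. 1)"
    by (intro bigoI_tendsto[where c = "\<bar>v 0\<bar> powr a"]) auto
  have 1: "(\<lambda>d. (\<beta> d - \<beta> 0) * \<bar>v d\<bar> powr a) \<in> O[at_right 0](\<lambda>d. d)"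
    using landau_o.big.mult[OF DERIV_imp_bigo_at_right[OF \<beta>] bdd] by simp
  show ?thesis
  proof (cases "v 0 = 0")
    case False
    \<comment> \<open>Squaring removes the absolute value, so the sign of \<open>v 0\<close> needs
      no case distinction.\<close>
    have "((\<lambda>t. (v t)\<^sup>2 powr (a/2)) has_real_derivative
            ((v 0)\<^sup>2 powr (a/2) * (0 * ln ((v 0)\<^sup>2) + (2 * v 0 * v' 0) * (a/2) / (v 0)\<^sup>2))) (at 0)"
      using False by (intro DERIV_powr) (auto intro!: derivative_eq_intros v)
    moreover have "(v t)\<^sup>2 powr (a/2) = \<bar>v t\<bar> powr a" for t
    proof -
      have "(v t)\<^sup>2 = \<bar>v t\<bar> powr 2" by (cases "v t = 0") auto
      then show ?thesis unfolding powr_powr by (simp add: powr_powr del: powr_numeral)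
    qed
    ultimately have "\<exists>l. ((\<lambda>t. \<bar>v t\<bar> powr a) has_real_derivative l) (at 0)" by auto
    then have 2: "(\<lambda>d. \<bar>v d\<bar> powr a - \<bar>v 0\<bar> powr a) \<in> O[at_right 0](\<lambda>d. d)"
      using DERIV_imp_bigo_at_right by auto
    have "(\<lambda>d. (\<beta> d - \<beta> 0) * \<bar>v d\<bar> powr a + \<beta> 0 * (\<bar>v d\<bar> powr a - \<bar>v 0\<bar> powr a)) \<in> O[at_right 0](\<lambda>d. d)"
      by (rule sum_in_bigo(1)[OF 1]) (cases "\<beta> 0 = 0"; use 2 in simp)
    then show ?thesis using False by (simp add: algebra_simps)
  next
    case True
    have "(\<lambda>d. \<bar>v d\<bar> powr a - \<bar>v' 0\<bar> powr a * d powr a) \<in> O[at_right 0](\<lambda>d. d)"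
    proof (rule bigoI[where c = "\<bar>C\<bar> powr a"])
      have "\<forall>\<^sub>F d in at_right (0::real). d \<in> {0<..<1}"
        by (rule eventually_at_right_real) simp
      then show "\<forall>\<^sub>F d in at_right 0. norm (\<bar>v d\<bar> powr a - \<bar>v' 0\<bar> powr a * d powr a) \<le> \<bar>C\<bar> powr a * norm d"
      proof eventually_elim
        case (elim d)
        obtain z where z: "0 < z" "z < d" "v d - v 0 = (d - 0) * v' z"
          using MVT2[of 0 d v v'] v elim by auto
        have C: "C \<ge> 0" using v'[of 1] by simp
        have "\<bar>\<bar>v d\<bar> powr a - \<bar>v' 0 * d\<bar> powr a\<bar> \<le> \<bar>v d - v' 0 * d\<bar> powr a"
          using a by (intro abs_powr_diff_le) auto
        also have "v d - v' 0 * d = d * (v' z - v' 0)"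
          using z True by (simp add: algebra_simps)
        also have "\<bar>d * (v' z - v' 0)\<bar> powr a \<le> (C * d\<^sup>2) powr a"
        proof (rule powr_mono2)
          have "\<bar>d * (v' z - v' 0)\<bar> \<le> d * (C * \<bar>z\<bar>)"
            using v'[of z] elim by (simp add: abs_mult)
          also have "\<dots> \<le> d * (C * d)"
            using z elim C by (intro mult_left_mono) auto
          finally show "\<bar>d * (v' z - v' 0)\<bar> \<le> C * d\<^sup>2" by (simp add: power2_eq_square ac_simps)
        qed (use a in auto)
        also have "\<dots> = \<bar>C\<bar> powr a * d powr (2 * a)"
        proof -
          have "d\<^sup>2 = d powr 2" using elim by simp
          then show ?thesis using C elim by (simp add: powr_mult powr_powr del: powr_numeral)
        qed
        also have "d powr (2 * a) \<le> d powr 1"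
          using a elim by (intro powr_mono') auto
        finally show ?case using elim
          by (simp add: abs_mult powr_mult mult_left_mono)
      qed
    qed
    then have 2: "(\<lambda>d. \<beta> 0 * (\<bar>v d\<bar> powr a - \<bar>v' 0\<bar> powr a * d powr a)) \<in> O[at_right 0](\<lambda>d. d)"
      by (cases "\<beta> 0 = 0") simp_all
    from sum_in_bigo(1)[OF 1 2] show ?thesis using True a
      by (simp add: algebra_simps)
  qed
qed

text \<open>By induction the terms before \<open>m\<close> are O(d), and the bounds \<open>M\<close>
  make the terms after \<open>m\<close> jointly O(\<open>d powr a (Suc m)\<close>). As
  \<open>a (Suc m) \<le> 1\<close>, the term \<open>c m * d powr a m\<close> is then itself
  O(\<open>d powr a (Suc m)\<close>), and division by \<open>d powr a m\<close> leaves a bound on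
  \<open>c m\<close> that tends to 0.\<close>

lemma powr_series_coeffs_zero:
  fixes D :: "nat \<Rightarrow> real \<Rightarrow> real" and a M c :: "nat \<Rightarrow> real"
  assumes a: "strict_mono a" "\<And>k. a k \<le> 1"
    and expansion: "\<And>k. (\<lambda>d. D k d - c k * d powr a k) \<in> O[at_right 0](\<lambda>d. d)"
    and bound: "\<And>k d. 0 < d \<Longrightarrow> d < 1 \<Longrightarrow> \<bar>D k d\<bar> \<le> M k * d powr a k"
    and M: "summable M"
    and series: "(\<lambda>d. \<Sum>k. D k d) \<in> O[at_right 0](\<lambda>d. d)"
  shows "c m = 0"
proof (induction m rule: less_induct)
  case (less m)
  let ?p = "a (Suc m)"
  have ev: "\<forall>\<^sub>F d in at_right (0::real). d \<in> {0<..<1}"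
    by (rule eventually_at_right_real) simp
  have ident: "(\<lambda>d. d) \<in> O[at_right 0](\<lambda>d. d powr ?p)"
    by (rule ident_bigo_powr_at_right_0) (rule a)
  have M0: "0 \<le> M k" for k
  proof -
    have "0 \<le> M k * (1/2) powr a k" using bound[of "1/2" k] by linarith
    then show ?thesis by (simp add: zero_le_mult_iff)
  qed
  have summ: "summable (\<lambda>k. D k d)" if "0 < d" "d < 1" for d
  proof (rule summable_comparison_test'[where N = 0])
    show "summable (\<lambda>k. M k * d powr a 0)" by (intro summable_mult2 M)
    fix k
    have "d powr a k \<le> d powr a 0"
      using that a(1) by (intro powr_mono') (auto simp: strict_mono_less_eq)
    with bound[OF that, of k] M0[of k] show "norm (D k d) \<le> M k * d powr a 0"
      by (smt (verit) mult_left_mono real_norm_def)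
  qed
  have tail: "(\<lambda>d. \<Sum>k. D (k + Suc m) d) \<in> O[at_right 0](\<lambda>d. d powr ?p)"
  proof (rule bigoI[where c = "\<Sum>k. M (k + Suc m)"])
    from ev show "\<forall>\<^sub>F d in at_right 0. norm (\<Sum>k. D (k + Suc m) d) \<le> (\<Sum>k. M (k + Suc m)) * norm (d powr ?p)"
    proof eventually_elim
      case (elim d)
      have sM: "summable (\<lambda>k. M (k + Suc m) * d powr ?p)"
        using M by (intro summable_mult2 summable_ignore_initial_segment)
      have le: "norm (D (k + Suc m) d) \<le> M (k + Suc m) * d powr ?p" for k
      proof -
        have "d powr a (k + Suc m) \<le> d powr ?p"
          using elim a(1) by (intro powr_mono') (auto simp: strict_mono_less_eq)
        with bound[of d "k + Suc m"] elim M0[of "k + Suc m"] show ?thesis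
          by (smt (verit) mult_left_mono real_norm_def greaterThanLessThan_iff)
      qed
      have "norm (\<Sum>k. D (k + Suc m) d) \<le> (\<Sum>k. M (k + Suc m) * d powr ?p)"
        by (rule norm_suminf_le[OF le sM])
      also have "\<dots> = (\<Sum>k. M (k + Suc m)) * d powr ?p"
        using M by (intro suminf_mult2[symmetric] summable_ignore_initial_segment)
      finally show ?case by simp
    qed
  qed
  have head: "(\<lambda>d. \<Sum>k<m. D k d) \<in> O[at_right 0](\<lambda>d. d)"
  proof (rule big_sum_in_bigo)
    fix k assume "k \<in> {..<m}"
    with less[of k] expansion[of k] show "D k \<in> O[at_right 0](\<lambda>d. d)" by simp
  qed
  have "(\<lambda>d. (\<Sum>k. D k d) - (\<Sum>k<m. D k d) - (\<Sum>k. D (k + Suc m) d) - (D m d - c m * d powr a m))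
          \<in> O[at_right 0](\<lambda>d. d powr ?p)"
    by (intro sum_in_bigo tail landau_o.big_trans[OF series ident]
        landau_o.big_trans[OF head ident] landau_o.big_trans[OF expansion ident])
  then have "(\<lambda>d. c m * d powr a m) \<in> O[at_right 0](\<lambda>d. d powr ?p)"
  proof (rule landau_o.big.in_cong[THEN iffD1, rotated])
    from ev show "\<forall>\<^sub>F d in at_right 0. (\<Sum>k. D k d) - (\<Sum>k<m. D k d) - (\<Sum>k. D (k + Suc m) d)
      - (D m d - c m * d powr a m) = c m * d powr a m"
    proof eventually_elim
      case (elim d)
      with suminf_split_initial_segment[OF summ[of d], of "Suc m"] show ?case by simp
    qed
  qed
  then obtain K where K: "\<forall>\<^sub>F d in at_right 0. norm (c m * d powr a m) \<le> K * norm (d powr ?p)"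
    by (elim landau_o.bigE)
  have "a m < ?p" using a(1) by (simp add: strict_mono_less)
  then have "((\<lambda>d. K * d powr (?p - a m)) \<longlongrightarrow> K * 0 powr (?p - a m)) (at_right 0)"
    by (intro tendsto_mult tendsto_const tendsto_powr' tendsto_ident_at)
      (auto intro: eventually_mono[OF eventually_at_right_less])
  moreover from K ev have "\<forall>\<^sub>F d in at_right 0. \<bar>c m\<bar> \<le> K * d powr (?p - a m)"
  proof eventually_elim
    case (elim d)
    then show ?case by (simp add: powr_diff field_simps abs_mult)
  qed
  ultimately have "\<bar>c m\<bar> \<le> K * 0 powr (?p - a m)"
    by (rule tendsto_lowerbound) simp
  then show "c m = 0" by simp
qed

section \<open>Functions that agree where they cross rational levels\<close>

lemma isCont_imp_eventually_neq:
  fixes f :: "real \<Rightarrow> real"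
  assumes "isCont f t" "f t \<noteq> c"
  shows "\<forall>\<^sub>F s in nhds t. f s \<noteq> c"
  using assms tendsto_imp_eventually_ne[of f "f t" "at t" c]
  by (simp add: isCont_def eventually_nhds_conv_at)

text \<open>If \<open>v' t \<noteq> 0\<close> and \<open>v t \<noteq> w t\<close>, both persist on a
  short interval; there \<open>v\<close> is not constant, so it takes a rational value, against
  \<open>vw\<close>. Hence \<open>v\<close> and \<open>w\<close> agree wherever one of the
  derivatives is nonzero. It follows that the derivatives agree everywhere, so \<open>v - w\<close>
  is constant, and this constant is 0 unless \<open>v'\<close> vanishes identically.\<close>

lemma eq_or_locally_constant:
  fixes v w v' w' :: "real \<Rightarrow> real"
  assumes v: "\<And>t. (v has_real_derivative v' t) (at t)" and w: "\<And>t. (w has_real_derivative w' t) (at t)"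
    and v': "\<And>t. isCont v' t" and w': "\<And>t. isCont w' t"
    and vw: "\<And>t. v t \<in> \<rat> \<Longrightarrow> v' t \<noteq> 0 \<Longrightarrow> w t = v t"
    and wv: "\<And>t. w t \<in> \<rat> \<Longrightarrow> w' t \<noteq> 0 \<Longrightarrow> v t = w t"
  shows "v = w \<or> (\<forall>t. v t = v 0)"
proof -
  have key: "f t = g t"
    if f: "\<And>t. (f has_real_derivative f' t) (at t)" and g: "\<And>t. (g has_real_derivative g' t) (at t)"
      and f': "\<And>t. isCont f' t" and fg: "\<And>t. f t \<in> \<rat> \<Longrightarrow> f' t \<noteq> 0 \<Longrightarrow> g t = f t" and ne: "f' t \<noteq> 0"
    for f g f' g' :: "real \<Rightarrow> real" and t
  proof (rule ccontr)
    assume neq: "f t \<noteq> g t"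
    have fc: "isCont f s" and gc: "isCont g s" for s using f g DERIV_isCont by blast+
    have "\<forall>\<^sub>F s in nhds t. f' s \<noteq> 0"
      by (rule isCont_imp_eventually_neq[OF f' ne])
    moreover have "\<forall>\<^sub>F s in nhds t. f s - g s \<noteq> 0"
      using neq by (intro isCont_imp_eventually_neq continuous_diff fc gc) auto
    ultimately have "\<forall>\<^sub>F s in nhds t. f' s \<noteq> 0 \<and> f s - g s \<noteq> 0" by (rule eventually_conj)
    then obtain e where e: "e > 0" "\<And>s. dist s t < e \<Longrightarrow> f' s \<noteq> 0 \<and> f s \<noteq> g s"
      by (auto simp: eventually_nhds_metric)
    define r where "r = t + e / 2"
    have r: "t < r" "\<And>s. t \<le> s \<Longrightarrow> s \<le> r \<Longrightarrow> f' s \<noteq> 0 \<and> f s \<noteq> g s"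
      using e by (auto simp: r_def dist_real_def)
    obtain z where z: "t < z" "z < r" "f r - f t = (r - t) * f' z"
      using MVT2[OF r(1), of f f'] f by auto
    then have "f r \<noteq> f t" using r(2)[of z] r(1) by auto
    then have "min (f t) (f r) < max (f t) (f r)" by linarith
    then obtain q where q: "q \<in> \<rat>" "min (f t) (f r) < q" "q < max (f t) (f r)"
      using Rats_dense_in_real by blast
    have "\<exists>s. t \<le> s \<and> s \<le> r \<and> f s = q"
      using q r(1) fc IVT[of f t q r] IVT2[of f r q t] by (auto simp: min_def max_def split: if_splits)
    then obtain s where "t \<le> s" "s \<le> r" "f s = q" by blast
    with fg[of s] q r(2)[of s] show False by auto
  qed
  have off: "v t = w t" if "v' t \<noteq> 0 \<or> w' t \<noteq> 0" for t
    using key[OF v w v' vw] key[OF w v w' wv] that by metis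
  have v'w': "v' t = w' t" for t
  proof (rule ccontr)
    assume ne: "v' t \<noteq> w' t"
    \<comment> \<open>A derivative that is nonzero at \<open>t\<close>. It stays nonzero near
      \<open>t\<close>, so \<open>v\<close> and \<open>w\<close> coincide near \<open>t\<close> and
      have the same derivative there.\<close>
    define u where "u = (if v' t \<noteq> 0 then v' else w')"
    have u: "isCont u t" "u t \<noteq> 0" using ne v' w' by (auto simp: u_def)
    then have "\<forall>\<^sub>F s in nhds t. u s \<noteq> 0" by (rule isCont_imp_eventually_neq)
    then have "\<forall>\<^sub>F s in nhds t. v s = w s"
      by eventually_elim (use off in \<open>auto simp: u_def split: if_splits\<close>)
    then have "(v has_real_derivative w' t) (at t)"
      using w[of t] DERIV_cong_ev[of t t v w "w' t" "w' t"] by simp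
    with v[of t] ne show False using DERIV_unique by blast
  qed
  have diff: "v t - w t = v 0 - w 0" for t
    using DERIV_isconst_all[of "\<lambda>t. v t - w t" t 0] DERIV_diff[OF v w] v'w' by force
  show ?thesis
  proof (cases "\<exists>t. v' t \<noteq> 0")
    case True
    then obtain t where "v t = w t" using off by blast
    with diff[of t] diff have "v = w" by auto
    then show ?thesis ..
  next
    case False
    then show ?thesis using DERIV_isconst_all[of v _ 0] v by metis
  qed
qed

section \<open>Exponential averages\<close>

text \<open>Substituting \<open>s + t\<close> moves \<open>t\<close> from the integrand to the
  limits of integration, so that mere continuity of \<open>\<gamma>\<close> makes the average
  differentiable in \<open>t\<close>.\<close>

lemma exp_average_eq_antiderivative:
  fixes \<gamma> :: "real \<Rightarrow> real"
  assumes "continuous_on UNIV \<gamma>"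
  obtains G where "\<And>t. (G has_real_derivative exp (-t) * \<gamma> t) (at t)"
    and "\<And>t. integral {0..1} (\<lambda>s. exp (-s) * \<gamma> (s + t)) = exp t * (G (t + 1) - G t)"
proof -
  have "isCont (\<lambda>t. exp (-t) * \<gamma> t) t" for t
    using assms by (intro continuous_intros) (auto simp: continuous_on_eq_continuous_at)
  then obtain G where G: "\<And>t. (G has_vector_derivative exp (-t) * \<gamma> t) (at t)"
    using einterval_antiderivative[of "-\<infinity>" "\<infinity>" "\<lambda>t. exp (-t) * \<gamma> t"] by auto
  then have G': "(G has_real_derivative exp (-t) * \<gamma> t) (at t)" for t
    by (simp add: has_real_derivative_iff_has_vector_derivative)
  have "integral {0..1} (\<lambda>s. exp (-s) * \<gamma> (s + t)) = exp t * (G (t + 1) - G t)" for t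
  proof (rule integral_unique)
    have "((\<lambda>s. exp t * G (s + t)) has_real_derivative exp (-s) * \<gamma> (s + t)) (at s)" for s
    proof -
      have "((\<lambda>s. exp t * G (s + t)) has_real_derivative exp t * (exp (-(s + t)) * \<gamma> (s + t))) (at s)"
        using G'[of "s + t"] by (intro DERIV_cmult) (simp add: DERIV_shift)
      moreover have "exp t * exp (-(s + t)) = exp (-s)" by (simp flip: exp_add)
      ultimately show ?thesis by (metis mult.assoc)
    qed
    then have "((\<lambda>s. exp (-s) * \<gamma> (s + t)) has_integral (exp t * G (1 + t) - exp t * G (0 + t))) {0..1}"
      by (intro fundamental_theorem_of_calculus)
        (auto simp flip: has_real_derivative_iff_has_vector_derivative intro: has_field_derivative_at_within)
    then show "((\<lambda>s. exp (-s) * \<gamma> (s + t)) has_integral exp t * (G (t + 1) - G t)) {0..1}"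
      by (simp add: algebra_simps)
  qed
  with G' show thesis by (rule that)
qed

lemma exp_average_has_derivative:
  fixes \<gamma> :: "real \<Rightarrow> real"
  assumes "continuous_on UNIV \<gamma>"
  defines "u \<equiv> \<lambda>t. integral {0..1} (\<lambda>s. exp (-s) * \<gamma> (s + t))"
  shows "(u has_real_derivative u t + exp (-1) * \<gamma> (t + 1) - \<gamma> t) (at t)"
proof -
  obtain G where G: "\<And>t. (G has_real_derivative exp (-t) * \<gamma> t) (at t)"
    and u: "\<And>t. u t = exp t * (G (t + 1) - G t)"
    unfolding u_def by (rule exp_average_eq_antiderivative[OF assms(1)]) blast
  have deriv: "((\<lambda>t. exp t * (G (t + 1) - G t)) has_real_derivative
      exp t * (exp (- (t + 1)) * \<gamma> (t + 1) - exp (- t) * \<gamma> t) + exp t * (G (t + 1) - G t)) (at t)"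
  proof -
    have "((\<lambda>t. G (t + 1)) has_real_derivative exp (- (t + 1)) * \<gamma> (t + 1)) (at t)"
      using G[of "t + 1"] by (simp add: DERIV_shift)
    from DERIV_mult[OF DERIV_exp DERIV_diff[OF this G]] show ?thesis
      by (simp add: add.commute mult.commute)
  qed
  have eq: "exp t * (exp (- (t + 1)) * \<gamma> (t + 1) - exp (- t) * \<gamma> t) + exp t * (G (t + 1) - G t)
      = u t + exp (-1) * \<gamma> (t + 1) - \<gamma> t"
  proof -
    have "exp t * exp (- (t + 1)) = exp (-1)" "exp t * exp (- t) = 1" by (simp_all flip: exp_add)
    then have "exp t * (exp (- (t + 1)) * \<gamma> (t + 1) - exp (- t) * \<gamma> t) = exp (-1) * \<gamma> (t + 1) - \<gamma> t"
      by (metis right_diff_distrib mult.assoc mult_1)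
    then show ?thesis unfolding u by simp
  qed
  have "u = (\<lambda>t. exp t * (G (t + 1) - G t))" using u by blast
  with deriv show ?thesis unfolding eq by simp
qed

text \<open>Iteration gives \<open>w t = r ^ n * w (t + real n)\<close>, which tends to 0 since
  \<open>w\<close> is bounded.\<close>

lemma bounded_scaled_shift_imp_zero:
  fixes w :: "real \<Rightarrow> real"
  assumes "\<And>t. \<bar>w t\<bar> \<le> B" and shift: "\<And>t. w t = r * w (t + 1)" and "0 \<le> r" "r < 1"
  shows "w t = 0"
proof -
  have iter: "w t = r ^ n * w (t + real n)" for n
  proof (induction n)
    case (Suc n)
    then show ?case using shift[of "t + real n"] by (simp add: ac_simps)
  qed simp
  have "\<bar>w t\<bar> \<le> r ^ n * B" for n
    using iter[of n] assms(1)[of "t + real n"] assms(3) by (simp add: abs_mult mult_left_mono)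
  moreover have "(\<lambda>n. r ^ n * B) \<longlonglongrightarrow> 0 * B"
    using assms(3,4) by (intro tendsto_mult LIMSEQ_power_zero tendsto_const) auto
  ultimately have "\<bar>w t\<bar> \<le> 0 * B"
    by (intro LIMSEQ_le_const[of _ "0 * B"]) blast+
  then show ?thesis by simp
qed

section \<open>Series of continuous functions and separability of compact sets\<close>

lemma continuous_on_suminf:
  fixes f :: "nat \<Rightarrow> 'a::topological_space \<Rightarrow> real"
  assumes "\<And>n. continuous_on S (f n)" "\<And>n x. x \<in> S \<Longrightarrow> \<bar>f n x\<bar> \<le> M n" "summable M"
  shows "continuous_on S (\<lambda>x. \<Sum>n. f n x)"
proof (rule uniform_limit_theorem)
  show "uniform_limit S (\<lambda>n x. \<Sum>i<n. f i x) (\<lambda>x. \<Sum>i. f i x) sequentially"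
    by (rule Weierstrass_m_test) (use assms in auto)
  show "\<forall>\<^sub>F n in sequentially. continuous_on S (\<lambda>x. \<Sum>i<n. f i x)"
    using assms(1) by (intro always_eventually allI continuous_on_sum)
qed simp

lemma compact_countable_dense:
  fixes X :: "'a::metric_space set"
  assumes "compact X"
  obtains D where "countable D" "D \<subseteq> X" "\<And>x e. x \<in> X \<Longrightarrow> 0 < e \<Longrightarrow> \<exists>p\<in>D. dist x p < e"
proof -
  have "\<forall>n. \<exists>k. finite k \<and> k \<subseteq> X \<and> X \<subseteq> (\<Union>x\<in>k. ball x (1 / real (Suc n)))"
    using seq_compact_imp_totally_bounded[OF compact_imp_seq_compact[OF assms]] by auto
  then obtain K where K: "\<And>n. finite (K n)" "\<And>n. K n \<subseteq> X"
    "\<And>n. X \<subseteq> (\<Union>x\<in>K n. ball x (1 / real (Suc n)))" by metis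
  show thesis
  proof (rule that[of "\<Union>n. K n"])
    show "countable (\<Union>n. K n)" using K(1) by (intro countable_UN) (auto intro: countable_finite)
    fix x and e :: real assume "x \<in> X" "0 < e"
    from \<open>0 < e\<close> obtain n where n: "1 / real (Suc n) < e"
      by (rule nat_approx_posE)
    from \<open>x \<in> X\<close> K(3)[of n] obtain p where "p \<in> K n" "x \<in> ball p (1 / real (Suc n))"
      by blast
    with n have "p \<in> (\<Union>n. K n)" "dist x p < e"
      by (auto simp: dist_commute)
    then show "\<exists>p\<in>\<Union>n. K n. dist x p < e" ..
  qed (use K(2) in auto)
qed

section \<open>The space of Lipschitz functions\<close>

lemma LR_weights_sums: "(\<lambda>n. (1/2::real) ^ Suc n) sums 1"
  using power_half_series by simp

text \<open>The first \<open>N\<close> windows lie in [-N, N] and their weights sum to at most 1,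
  which gives \<open>c\<close>. The remaining terms are at most their weights, whose sum is
  \<open>(1/2) ^ N\<close>.\<close>

lemma LR_dist_le:
  assumes "\<And>t. \<bar>t\<bar> \<le> real N \<Longrightarrow> \<bar>LR_apply \<phi> t - LR_apply \<psi> t\<bar> \<le> c" "0 \<le> c"
  shows "dist \<phi> \<psi> \<le> c + (1/2) ^ N"
proof -
  let ?m = "\<lambda>n. (1/2) ^ Suc n * LR_maxdist (Suc n) \<phi> \<psi>"
  have w: "summable (\<lambda>n. (1/2::real) ^ Suc n)" using LR_weights_sums by (rule sums_summable)
  have "(\<Sum>n<N. ?m n) \<le> (\<Sum>n<N. (1/2) ^ Suc n * c)"
    by (intro sum_mono mult_left_mono LR_maxdist_least assms(1)) auto
  also have "\<dots> = (\<Sum>n<N. (1/2) ^ Suc n) * c" by (simp add: sum_distrib_right)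
  also have "\<dots> \<le> 1 * c"
    using sum_le_suminf[OF w, of "{..<N}"] sums_unique[OF LR_weights_sums] assms(2)
    by (intro mult_right_mono) auto
  finally have head: "(\<Sum>n<N. ?m n) \<le> c" by simp
  have "(\<Sum>n. ?m (n + N)) \<le> (\<Sum>n. (1/2) ^ N * (1/2) ^ Suc n)"
  proof (rule suminf_le)
    fix n
    have "?m (n + N) \<le> (1/2) ^ Suc (n + N) * 1"
      by (intro mult_left_mono LR_maxdist_le_1) simp
    then show "?m (n + N) \<le> (1/2) ^ N * (1/2) ^ Suc n" by (simp add: power_add ac_simps)
  qed (intro summable_ignore_initial_segment LR_dist_summable summable_mult w)+
  also have "\<dots> = (1/2) ^ N"
    using suminf_mult[OF w, of "(1/2) ^ N"] sums_unique[OF LR_weights_sums] by simp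
  finally have "(\<Sum>n. ?m (n + N)) \<le> (1/2) ^ N" .
  with head show ?thesis
    unfolding dist_LR_def suminf_split_initial_segment[OF LR_dist_summable, where k = N] by linarith
qed

text \<open>The point 0 lies in every window and the weights sum to 1.\<close>

lemma LR_apply_0_dist_le: "\<bar>LR_apply \<phi> 0 - LR_apply \<psi> 0\<bar> \<le> dist \<phi> \<psi>"
proof -
  let ?c = "\<bar>LR_apply \<phi> 0 - LR_apply \<psi> 0\<bar>"
  have "(\<Sum>n. (1/2) ^ Suc n * ?c) \<le> dist \<phi> \<psi>"
    unfolding dist_LR_def
    by (intro suminf_le LR_dist_summable summable_mult2 sums_summable[OF LR_weights_sums]
        mult_left_mono LR_maxdist_upper) auto
  then show ?thesis
    using suminf_mult2[OF sums_summable[OF LR_weights_sums], of ?c] sums_unique[OF LR_weights_sums]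
    by simp
qed

lemma continuous_on_LR_apply_0: "continuous_on S (\<lambda>\<phi>. LR_apply \<phi> 0)"
  unfolding continuous_on_iff
  by (metis LR_apply_0_dist_le dist_real_def le_less_trans)

context flow
begin

section \<open>Averages along the orbits of a flow\<close>

definition observables :: "('a \<Rightarrow> real) set" where
  "observables = {g. continuous_on X g \<and> g \<in> X \<rightarrow> {0..1}}"

text \<open>Without the weight, an observable of period 1 along an orbit would have a constant
  average there. The weight turns the end of the window into the factor \<open>exp (-1) < 1\<close>,
  which is what makes \<open>avg_determines\<close> work.\<close>

definition avg :: "('a \<Rightarrow> real) \<Rightarrow> 'a \<Rightarrow> real" where
  "avg g x = integral {0..1} (\<lambda>s. exp (-s) * g (T s x))"

text \<open>The time derivative of \<open>avg g\<close> along the orbit, as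
  \<open>avg_has_derivative\<close> shows.\<close>

definition avg_rate :: "('a \<Rightarrow> real) \<Rightarrow> 'a \<Rightarrow> real" where
  "avg_rate g x = avg g x + exp (-1) * g (T 1 x) - g x"

lemma action_in: "x \<in> X \<Longrightarrow> T t x \<in> X"
  using maps_to[of t] by blast

lemma observables_bounds: "g \<in> observables \<Longrightarrow> x \<in> X \<Longrightarrow> 0 \<le> g x \<and> g x \<le> 1"
  by (auto simp: observables_def)

lemma continuous_on_action:
  assumes "continuous_on S f" "continuous_on S h" "\<And>z. z \<in> S \<Longrightarrow> h z \<in> X"
  shows "continuous_on S (\<lambda>z. T (f z) (h z))"
  using continuous_on_compose2[OF continuous_action continuous_on_Pair[OF assms(1,2)]] assms(3)
  by auto

lemma continuous_on_observable_action:
  assumes "g \<in> observables" "continuous_on S f" "continuous_on S h" "\<And>z. z \<in> S \<Longrightarrow> h z \<in> X"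
  shows "continuous_on S (\<lambda>z. g (T (f z) (h z)))"
proof (rule continuous_on_compose2[of X g])
  show "continuous_on X g" using assms(1) by (simp add: observables_def)
qed (use assms action_in in \<open>auto intro: continuous_on_action\<close>)

lemma continuous_along_orbit:
  "g \<in> observables \<Longrightarrow> x \<in> X \<Longrightarrow> continuous_on S (\<lambda>t. g (T t x))"
  by (intro continuous_on_observable_action continuous_intros) auto

lemma avg_along_orbit:
  "x \<in> X \<Longrightarrow> avg g (T t x) = integral {0..1} (\<lambda>s. exp (-s) * g (T (s + t) x))"
  by (simp add: avg_def action_add)

lemma avg_has_derivative:
  assumes "g \<in> observables" "x \<in> X"
  shows "((\<lambda>t. avg g (T t x)) has_real_derivative avg_rate g (T t x)) (at t)"
  using exp_average_has_derivative[OF continuous_along_orbit[OF assms], of t] assms(2)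
  by (simp add: avg_along_orbit avg_rate_def action_add[symmetric] add.commute)

lemma integral_exp_0_1: "integral {0..1} (\<lambda>s::real. exp (-s)) = 1 - exp (-1)"
proof (rule integral_unique)
  have "((\<lambda>s::real. exp (-s)) has_integral (- exp (-1) - (- exp (-0)))) {0..1}"
    by (intro fundamental_theorem_of_calculus)
      (auto intro!: derivative_eq_intros simp flip: has_real_derivative_iff_has_vector_derivative)
  then show "((\<lambda>s::real. exp (-s)) has_integral (1 - exp (-1))) {0..1}" by simp
qed

lemma avg_integrable:
  assumes "g \<in> observables" "x \<in> X"
  shows "(\<lambda>s. exp (-s) * g (T s x)) integrable_on {0..1}"
  by (intro integrable_continuous_real continuous_intros continuous_along_orbit assms)

lemma avg_bounds:
  assumes "g \<in> observables" "x \<in> X"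
  shows "0 \<le> avg g x" "avg g x \<le> 1 - exp (-1)"
proof -
  have g: "0 \<le> g (T s x)" "g (T s x) \<le> 1" for s
    using observables_bounds[OF assms(1) action_in[OF assms(2)]] by auto
  show "0 \<le> avg g x"
    unfolding avg_def by (intro integral_nonneg avg_integrable assms) (simp add: g)
  have "avg g x \<le> integral {0..1} (\<lambda>s. exp (-s))"
    unfolding avg_def
    by (intro integral_le avg_integrable assms integrable_continuous_real continuous_intros)
       (simp add: g mult_left_le)
  then show "avg g x \<le> 1 - exp (-1)" by (simp add: integral_exp_0_1)
qed

lemma avg_observable:
  assumes "g \<in> observables"
  shows "avg g \<in> observables"
proof -
  have "continuous_on (X \<times> cbox 0 1) (\<lambda>(x, s). exp (-s) * g (T s x))"
    unfolding split_beta by (intro continuous_intros continuous_on_observable_action assms) auto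
  then have "continuous_on X (avg g)"
    unfolding avg_def[abs_def] using integral_continuous_on_param by fastforce
  then show ?thesis
    using avg_bounds[OF assms] by (force simp: observables_def intro: order_trans)
qed

text \<open>The bound \<open>1 - exp (-1)\<close> on the average and the bound
  \<open>exp (-1)\<close> on the second summand add up to exactly 1, so averages are 1-Lipschitz
  along orbits without rescaling.\<close>

lemma avg_rate_bound:
  assumes "g \<in> observables" "x \<in> X"
  shows "\<bar>avg_rate g x\<bar> \<le> 1"
proof -
  have "0 \<le> exp (-1) * g (T 1 x)" "exp (-1) * g (T 1 x) \<le> exp (-1)"
    using observables_bounds[OF assms(1) action_in[OF assms(2), of 1]]
    by (auto intro: mult_left_le)
  then show ?thesis
    using avg_bounds[OF assms] observables_bounds[OF assms] unfolding avg_rate_def by linarith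
qed

lemma avg_lipschitz:
  assumes "g \<in> observables" "x \<in> X"
  shows "\<bar>avg g (T s x) - avg g (T t x)\<bar> \<le> \<bar>s - t\<bar>"
proof -
  have "norm (avg g (T s x) - avg g (T t x)) \<le> 1 * norm (s - t)"
    by (rule field_differentiable_bound[of UNIV])
      (use avg_has_derivative[OF assms] avg_rate_bound[OF assms(1) action_in[OF assms(2)]] in auto)
  then show ?thesis by simp
qed

text \<open>Differentiating recovers \<open>g(t) - exp(-1) g(t + 1)\<close> along the orbit, which determines the
  bounded function \<open>g\<close>.\<close>

lemma avg_determines:
  assumes g: "g \<in> observables" and xy: "x \<in> X" "y \<in> X"
    and eq: "\<And>t. avg g (T t x) = avg g (T t y)"
  shows "g x = g y"
proof -
  define w where "w t = g (T t x) - g (T t y)" for t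
  have "w 0 = 0"
  proof (rule bounded_scaled_shift_imp_zero[where w = w and r = "exp (-1)" and B = 1])
    fix t
    show "\<bar>w t\<bar> \<le> 1"
      using observables_bounds[OF g action_in[OF xy(1), of t]]
        observables_bounds[OF g action_in[OF xy(2), of t]] by (simp add: w_def abs_le_iff)
    have "avg_rate g (T t x) = avg_rate g (T t y)"
      using avg_has_derivative[OF g xy(1), of t] avg_has_derivative[OF g xy(2), of t]
      unfolding eq by (rule DERIV_unique)
    then show "w t = exp (-1) * w (t + 1)"
      using xy by (simp add: w_def avg_rate_def eq action_add[symmetric] algebra_simps)
  qed auto
  then show ?thesis using xy by (simp add: w_def action_zero)
qed

section \<open>The fixed points\<close>

lemma Fix_subset: "Fix X T \<subseteq> X"
  by (auto simp: Fix_def)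

lemma action_Fix_iff: "x \<in> X \<Longrightarrow> T t x \<in> Fix X T \<longleftrightarrow> x \<in> Fix X T"
proof
  assume x: "x \<in> X" and fixed: "T t x \<in> Fix X T"
  have "x = T (-t) (T t x)" using action_add[OF x, of "-t" t] action_zero[OF x] by simp
  then have "T t x = x" using fixed by (simp add: Fix_def)
  with fixed show "x \<in> Fix X T" by simp
qed (simp add: Fix_def)

lemma closed_Fix: "closed (Fix X T)"
proof -
  have "Fix X T = X \<inter> (\<Inter>t. {x \<in> X. dist (T t x) x = 0})"
    by (auto simp: Fix_def)
  moreover have "closed {x \<in> X. dist (T t x) x = 0}" for t
    by (intro continuous_closed_preimage_constant compact_imp_closed[OF compact_space]
        continuous_intros continuous_on_action)
  ultimately show ?thesis
    using compact_imp_closed[OF compact_space] by (auto intro!: closed_Int closed_INT)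
qed

lemma compact_Fix: "compact (Fix X T)"
  using compact_Int_closed[OF compact_space closed_Fix] Fix_subset by (simp add: inf.absorb2)

lemma avg_Fix: "x \<in> Fix X T \<Longrightarrow> avg g x = (1 - exp (-1)) * g x"
  by (simp add: avg_def Fix_def integral_exp_0_1)

text \<open>A continuous nonnegative integrand with integral 0 vanishes identically. This will make
  the weight \<open>avg b\<close> of the waves positive off the fixed points.\<close>

lemma avg_pos:
  assumes g: "g \<in> observables" and x: "x \<in> X" and pos: "\<And>t. 0 < g (T t x)"
  shows "0 < avg g x"
proof -
  have "integral {0..1} (\<lambda>s. exp (-s) * g (T s x)) = 0 \<longleftrightarrow> (\<forall>s\<in>{0..1}. exp (-s) * g (T s x) = 0)"
    by (intro integral_eq_0_iff continuous_intros continuous_along_orbit g x)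
      (simp_all add: less_imp_le pos)
  moreover have "exp (-0) * g (T 0 x) \<noteq> 0" using pos[of 0] by simp
  ultimately have "integral {0..1} (\<lambda>s. exp (-s) * g (T s x)) \<noteq> 0" by fastforce
  then show ?thesis using avg_bounds(1)[OF g x] by (simp add: avg_def)
qed

lemma ex_observable_zero_iff_Fix: "\<exists>b\<in>observables. \<forall>x\<in>X. b x = 0 \<longleftrightarrow> x \<in> Fix X T"
proof (cases "Fix X T = {}") \<comment> \<open>\<^const>\<open>infdist\<close> to the empty set is \<open>0\<close>\<close>
  case True
  then show ?thesis by (intro bexI[of _ "\<lambda>_. 1"]) (auto simp: observables_def)
next
  case False
  show ?thesis
  proof (intro bexI[of _ "\<lambda>x. min 1 (infdist x (Fix X T))"] ballI)
    show "(\<lambda>x. min 1 (infdist x (Fix X T))) \<in> observables"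
      by (auto simp: observables_def infdist_nonneg intro!: continuous_intros)
    show "min 1 (infdist x (Fix X T)) = 0 \<longleftrightarrow> x \<in> Fix X T" for x
      using in_closed_iff_infdist_zero[OF closed_Fix False, of x] by (auto simp: min_def)
  qed
qed

text \<open>Truncated distances to the points of a countable dense set. A single \<open>k\<close>
  has to serve for \<open>y\<close> and \<open>z\<close> at once: later \<open>z\<close> is another
  point of the orbit of \<open>x\<close>.\<close>

lemma ex_separating_observables:
  obtains g :: "nat \<Rightarrow> 'a \<Rightarrow> real" where "\<And>k. g k \<in> observables"
    and "\<And>x y z. x \<in> X \<Longrightarrow> y \<in> X \<Longrightarrow> z \<in> X \<Longrightarrow> y \<noteq> x \<Longrightarrow> z \<noteq> x \<Longrightarrow> \<exists>k. g k x \<noteq> g k y \<and> g k x \<noteq> g k z"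
proof -
  obtain D where D: "countable D" "\<And>x e. x \<in> X \<Longrightarrow> 0 < e \<Longrightarrow> \<exists>p\<in>D. dist x p < e"
    using compact_countable_dense[OF compact_space] by metis
  define g where "g k x = min 1 (dist x (from_nat_into D k))" for k x
  show thesis
  proof (rule that[of g])
    show "g k \<in> observables" for k
      by (auto simp: observables_def g_def intro!: continuous_intros)
    fix x y z assume xyz: "x \<in> X" "y \<in> X" "z \<in> X" "y \<noteq> x" "z \<noteq> x"
    \<comment> \<open>A dense point within \<open>r\<close> of \<open>x\<close> is farther than
      \<open>r\<close> from \<open>y\<close> and \<open>z\<close>. Since \<open>r \<le> 1/2\<close>,
      the truncation at 1 does not spoil the comparison.\<close>
    define r where "r = min 1 (min (dist x y) (dist x z)) / 2"
    have "r > 0" using xyz by (auto simp: r_def)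
    from D(2)[OF xyz(1) this] obtain p where p: "p \<in> D" "dist x p < r" by blast
    then obtain k where k: "p = from_nat_into D k"
      using from_nat_into_surj[OF D(1)] by metis
    have "r < dist u p" if "dist x u \<ge> 2 * r" for u
      using dist_triangle[of x u p] p(2) that by (simp add: dist_commute)
    then have "r < dist y p" "r < dist z p" by (auto simp: r_def)
    with p(2) show "\<exists>k. g k x \<noteq> g k y \<and> g k x \<noteq> g k z"
      by (intro exI[of _ k]) (auto simp: g_def k r_def min_def split: if_splits)
  qed
qed

section \<open>Embeddings\<close>

text \<open>The map records \<open>F\<close> along the orbit of each point. It is continuous and
  injective, and on a compact space with Hausdorff target this suffices for an embedding.\<close>

lemma embeds_in_LR_if_separating:
  assumes F: "F \<in> observables"
    and lip: "\<And>x s t. x \<in> X \<Longrightarrow> \<bar>F (T s x) - F (T t x)\<bar> \<le> \<bar>s - t\<bar>"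
    and sep: "\<And>x y. x \<in> X \<Longrightarrow> y \<in> X \<Longrightarrow> (\<And>t. F (T t x) = F (T t y)) \<Longrightarrow> x = y"
  shows "equivariantly_embeds_in_LR X T"
proof -
  define I where "I x = LR_of (\<lambda>t. F (T t x))" for x
  have I: "LR_apply (I x) t = F (T t x)" if "x \<in> X" for x t
    unfolding I_def using observables_bounds[OF F action_in[OF that]] lip[OF that]
    by (subst LR_of_inverse) auto
  have "continuous_on X I"
    unfolding continuous_on_iff
  proof (intro ballI allI impI)
    fix x and e :: real assume x: "x \<in> X" and e: "0 < e"
    \<comment> \<open>Times beyond \<open>N\<close> contribute less than \<open>e / 2\<close> to the
      distance; the other half comes from uniform continuity on the compact set
      \<open>?K\<close>.\<close>
    obtain N where N: "(1/2) ^ N < e / 2" using real_arch_pow_inv[of "e/2" "1/2"] e by auto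
    let ?K = "{- real N..real N} \<times> X"
    have "uniformly_continuous_on ?K (\<lambda>(t, x). F (T t x))"
      unfolding split_beta
      by (intro compact_uniformly_continuous compact_Times compact_space compact_Icc
          continuous_on_observable_action F continuous_intros) auto
    then obtain d where d: "d > 0" "\<And>p q. p \<in> ?K \<Longrightarrow> q \<in> ?K \<Longrightarrow> dist q p < d \<Longrightarrow>
        dist (F (T (fst q) (snd q))) (F (T (fst p) (snd p))) < e / 2"
      unfolding uniformly_continuous_on_def split_beta using e by (metis half_gt_zero)
    show "\<exists>d>0. \<forall>y\<in>X. dist y x < d \<longrightarrow> dist (I y) (I x) < e"
    proof (intro exI[of _ d] conjI ballI impI)
      fix y assume y: "y \<in> X" "dist y x < d"
      have "dist (I y) (I x) \<le> e / 2 + (1/2) ^ N"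
      proof (rule LR_dist_le)
        fix t assume "\<bar>t\<bar> \<le> real N"
        then show "\<bar>LR_apply (I y) t - LR_apply (I x) t\<bar> \<le> e / 2"
          using d(2)[of "(t, x)" "(t, y)"] x y
          by (simp add: I dist_Pair_Pair dist_real_def abs_le_iff)
      qed (use e in simp)
      with N show "dist (I y) (I x) < e" by linarith
    qed (rule d)
  qed
  moreover have "inj_on I X" by (intro inj_onI sep) (auto simp flip: I)
  ultimately have "embedding_map (top_of_set X) euclidean I"
    using compact_space by (intro continuous_imp_embedding_map) (auto simp: compact_space_subtopology)
  moreover have "I (T s x) = LR_translate s (I x)" if "x \<in> X" for x s
  proof -
    have "LR_apply (I (T s x)) = LR_apply (LR_translate s (I x))"
      using that by (intro ext) (simp add: I action_in LR_apply_translate action_add)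
    then show ?thesis by (simp add: LR_apply_inject)
  qed
  ultimately show ?thesis unfolding equivariantly_embeds_in_LR_def by blast
qed

lemma Fix_embeds_if_embeds_in_LR:
  assumes "equivariantly_embeds_in_LR X T"
  shows "\<exists>g :: 'a \<Rightarrow> real. embedding_map (top_of_set (Fix X T)) (top_of_set {0..1}) g"
proof -
  obtain f :: "'a \<Rightarrow> LR" where emb: "embedding_map (top_of_set X) euclidean f"
    and equiv: "\<And>x s. x \<in> X \<Longrightarrow> f (T s x) = LR_translate s (f x)"
    using assms unfolding equivariantly_embeds_in_LR_def by blast
  have "homeomorphic_map (top_of_set X) (top_of_set (f ` X)) f"
    using emb by (simp add: embedding_map_def)
  then have cont: "continuous_on X f" and inj: "inj_on f X"
    using homeomorphic_imp_continuous_map homeomorphic_imp_injective_map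
    by (fastforce simp: continuous_map_in_subtopology)+
  define g where "g x = LR_apply (f x) 0" for x
  have "continuous_on (Fix X T) g"
    unfolding g_def
    by (rule continuous_on_compose2[OF continuous_on_LR_apply_0])
      (use cont Fix_subset continuous_on_subset in auto)
  moreover have "inj_on g (Fix X T)"
  proof (rule inj_onI)
    fix x y assume xy: "x \<in> Fix X T" "y \<in> Fix X T" "g x = g y"
    have const: "LR_apply (f z) t = g z" if "z \<in> Fix X T" for z t
      using that equiv[of z t] LR_apply_translate[of t "f z" 0] by (simp add: Fix_def g_def)
    have "LR_apply (f x) = LR_apply (f y)" using xy by (auto simp: const)
    then have "f x = f y" by (simp add: LR_apply_inject)
    then show "x = y" using inj_onD[OF inj] xy Fix_subset by blast
  qed
  ultimately have "embedding_map (top_of_set (Fix X T)) euclidean g"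
    using compact_Fix by (intro continuous_imp_embedding_map) (auto simp: compact_space_subtopology)
  moreover have "g ` Fix X T \<subseteq> {0..1}" by (auto simp: g_def LR_apply_bounds)
  ultimately show ?thesis by (auto simp: embedding_map_in_subtopology)
qed

text \<open>Tietze extension of \<open>h\<close> from the closed set of fixed points, with values
  kept in [0, 1].\<close>

lemma ex_observable_inj_on_Fix:
  assumes "embedding_map (top_of_set (Fix X T)) (top_of_set {0..1}) (h :: 'a \<Rightarrow> real)"
  shows "\<exists>H\<in>observables. inj_on H (Fix X T)"
proof -
  have emb: "embedding_map (top_of_set (Fix X T)) euclidean h" and im: "h ` Fix X T \<subseteq> {0..1}"
    using assms by (auto simp: embedding_map_in_subtopology)
  have "homeomorphic_map (top_of_set (Fix X T)) (top_of_set (h ` Fix X T)) h"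
    using emb by (simp add: embedding_map_def)
  then have cont: "continuous_map (top_of_set (Fix X T)) euclidean h" and inj: "inj_on h (Fix X T)"
    using homeomorphic_imp_continuous_map homeomorphic_imp_injective_map
    by (fastforce simp: continuous_map_in_subtopology)+
  have "closedin (top_of_set X) (Fix X T)"
    using closed_Fix Fix_subset by (simp add: closed_subset)
  moreover have "normal_space (top_of_set X)"
    using compact_space by (intro compact_Hausdorff_or_regular_imp_normal_space)
      (auto simp: compact_space_subtopology Hausdorff_space_subtopology)
  moreover have "continuous_map (subtopology (top_of_set X) (Fix X T)) euclidean h"
    using cont Fix_subset by (simp add: subtopology_subtopology inf.absorb2)
  ultimately obtain H where "continuous_map (top_of_set X) euclideanreal H"
      "\<And>x. x \<in> Fix X T \<Longrightarrow> H x = h x" "H ` topspace (top_of_set X) \<subseteq> {0..1}"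
    using Tietze_extension_closed_real_interval[of "top_of_set X" "Fix X T" h 0 1] im by auto
  then have "H \<in> observables" "inj_on H (Fix X T)"
    using inj by (auto simp: observables_def inj_on_def)
  then show ?thesis by blast
qed

section \<open>Separating points by singularities along orbits\<close>

text \<open>The weight \<open>avg b\<close> makes the waves vanish on the fixed points; along an orbit a wave has a
  singularity of order exactly \<open>a\<close> at the times when \<open>avg (avg g)\<close> crosses the level \<open>q\<close> with
  nonzero speed.\<close>

definition wave :: "('a \<Rightarrow> real) \<Rightarrow> ('a \<Rightarrow> real) \<Rightarrow> real \<Rightarrow> real \<Rightarrow> 'a \<Rightarrow> real" where
  "wave b g q a x = avg b x * \<bar>avg (avg g) x - q\<bar> powr a"

text \<open>The coefficient of \<open>d powr a\<close> in the increment of the wave over a small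
  positive time \<open>d\<close>; see \<open>wave_expansion\<close>.\<close>

definition wave_coeff :: "('a \<Rightarrow> real) \<Rightarrow> ('a \<Rightarrow> real) \<Rightarrow> real \<Rightarrow> real \<Rightarrow> 'a \<Rightarrow> real" where
  "wave_coeff b g q a x =
    (if avg (avg g) x = q then avg b x * \<bar>avg_rate (avg g) x\<bar> powr a else 0)"

text \<open>The reason for averaging twice: the rate of \<open>avg g\<close> involves
  \<open>g\<close>, which is only continuous, while that of \<open>avg (avg g)\<close> is Lipschitz
  along orbits, as \<open>powr_singularity_expansion\<close> requires. Each of its three summands
  contributes 1 to the constant.\<close>

lemma avg_rate_avg_lipschitz:
  assumes g: "g \<in> observables" and x: "x \<in> X"
  shows "\<bar>avg_rate (avg g) (T t x) - avg_rate (avg g) (T 0 x)\<bar> \<le> 3 * \<bar>t\<bar>"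
proof -
  have 1: "\<bar>avg (avg g) (T t x) - avg (avg g) (T 0 x)\<bar> \<le> \<bar>t\<bar>"
    using avg_lipschitz[OF avg_observable[OF g] x, of t 0] by simp
  have 2: "\<bar>avg g (T t x) - avg g (T 0 x)\<bar> \<le> \<bar>t\<bar>"
    using avg_lipschitz[OF g x, of t 0] by simp
  have 3: "\<bar>avg g (T (1 + t) x) - avg g (T 1 x)\<bar> \<le> \<bar>t\<bar>"
    using avg_lipschitz[OF g x, of "1 + t" 1] by simp
  have "\<bar>exp (-1) * (avg g (T (1 + t) x) - avg g (T 1 x))\<bar> \<le> 1 * \<bar>t\<bar>"
    unfolding abs_mult using 3 by (intro mult_mono) auto
  with 1 2 show ?thesis
    using x by (simp add: avg_rate_def action_add action_zero action_in algebra_simps)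
qed

lemma wave_expansion:
  assumes b: "b \<in> observables" and g: "g \<in> observables" and x: "x \<in> X" and a: "1 / 2 \<le> a" "a \<le> 1"
  shows "(\<lambda>d. wave b g q a (T d x) - wave b g q a x - wave_coeff b g q a x * d powr a)
    \<in> O[at_right 0](\<lambda>d. d)"
proof -
  have "((\<lambda>t. avg (avg g) (T t x) - q) has_real_derivative avg_rate (avg g) (T t x)) (at t)" for t
    using DERIV_diff[OF avg_has_derivative[OF avg_observable[OF g] x, of t] DERIV_const[of q]] by simp
  from powr_singularity_expansion[OF avg_has_derivative[OF b x] this avg_rate_avg_lipschitz[OF g x] a]
  show ?thesis using x
    by (cases "avg (avg g) x = q") (simp_all add: wave_def wave_coeff_def action_zero)
qed

lemma wave_bounds:
  assumes b: "b \<in> observables" and g: "g \<in> observables" and q: "q \<in> {0..1}" and x: "x \<in> X" and a: "0 \<le> a"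
  shows "0 \<le> wave b g q a x" "wave b g q a x \<le> 1"
proof -
  have "\<bar>avg (avg g) x - q\<bar> \<le> 1"
    using observables_bounds[OF avg_observable[OF avg_observable[OF g]] x] q by (simp add: abs_le_iff)
  then have "\<bar>avg (avg g) x - q\<bar> powr a \<le> 1" using a by (simp add: powr_le1)
  then show "0 \<le> wave b g q a x" "wave b g q a x \<le> 1"
    using observables_bounds[OF avg_observable[OF b] x] by (auto simp: wave_def intro: mult_le_one)
qed

text \<open>In the product rule for increments, the Lipschitz factor and the power factor each
  contribute at most \<open>d powr a\<close>. The constant 2 is the same for all waves, so the
  bounds can be summed over the series.\<close>

lemma wave_increment_le:
  assumes b: "b \<in> observables" and g: "g \<in> observables" and q: "q \<in> {0..1}" and x: "x \<in> X"
    and a: "0 < a" "a \<le> 1" and d: "0 < d" "d < 1"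
  shows "\<bar>wave b g q a (T d x) - wave b g q a x\<bar> \<le> 2 * d powr a"
proof -
  let ?p = "\<lambda>t. \<bar>avg (avg g) (T t x) - q\<bar> powr a"
  have p: "0 \<le> ?p d" "?p d \<le> 1"
    using observables_bounds[OF avg_observable[OF avg_observable[OF g]] action_in[OF x, of d]] q a
    by (auto intro!: powr_le1 simp: abs_le_iff)
  have "d powr 1 \<le> d powr a" using a d by (intro powr_mono') auto
  then have "\<bar>avg b (T d x) - avg b (T 0 x)\<bar> \<le> d powr a"
    using avg_lipschitz[OF b x, of d 0] d by simp
  then have 1: "\<bar>(avg b (T d x) - avg b (T 0 x)) * ?p d\<bar> \<le> d powr a * 1"
    unfolding abs_mult using p by (intro mult_mono) auto
  have "\<bar>?p d - ?p 0\<bar> \<le> \<bar>(avg (avg g) (T d x) - q) - (avg (avg g) (T 0 x) - q)\<bar> powr a"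
    by (rule abs_powr_diff_le[OF a])
  also have "\<dots> \<le> d powr a"
    using avg_lipschitz[OF avg_observable[OF g] x, of d 0] d a by (intro powr_mono2) auto
  finally have 2: "\<bar>avg b (T 0 x) * (?p d - ?p 0)\<bar> \<le> 1 * d powr a"
    unfolding abs_mult
    using observables_bounds[OF avg_observable[OF b] action_in[OF x, of 0]] by (intro mult_mono) auto
  have "wave b g q a (T d x) - wave b g q a (T 0 x)
      = (avg b (T d x) - avg b (T 0 x)) * ?p d + avg b (T 0 x) * (?p d - ?p 0)"
    by (simp add: wave_def algebra_simps)
  with 1 2 have "\<bar>wave b g q a (T d x) - wave b g q a (T 0 x)\<bar> \<le> 2 * d powr a" by linarith
  then show ?thesis using x by (simp add: action_zero)
qed

lemma wave_observable:
  assumes "b \<in> observables" "g \<in> observables" "q \<in> {0..1}" "0 < a"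
  shows "wave b g q a \<in> observables"
proof -
  have "continuous_on X (avg b)" "continuous_on X (avg (avg g))"
    using assms(1,2) avg_observable by (auto simp: observables_def)
  then have "continuous_on X (wave b g q a)"
    unfolding wave_def using \<open>0 < a\<close> by (intro continuous_intros continuous_on_powr') auto
  then show ?thesis using wave_bounds[OF assms(1-3)] assms(4) by (auto simp: observables_def)
qed

text \<open>The increments of \<open>f\<close> along the two orbits coincide and those of
  \<open>avg H\<close> are O(d), so the differences of the wave increments sum to O(d). The
  exponents being distinct, \<open>powr_series_coeffs_zero\<close> makes the coefficients cancel one
  by one.\<close>

lemma wave_coeffs_determined:
  fixes a q :: "nat \<Rightarrow> real"
  assumes b: "b \<in> observables" and H: "H \<in> observables" and g: "\<And>k. g k \<in> observables"
    and q: "\<And>k. q k \<in> {0..1}" and a: "strict_mono a" "\<And>k. 1 / 2 \<le> a k" "\<And>k. a k \<le> 1"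
    and xy: "x \<in> X" "y \<in> X"
  defines "f \<equiv> \<lambda>x. avg H x + (\<Sum>k. (1/2) ^ Suc k * wave b (g k) (q k) (a k) x)"
  assumes eq: "\<And>t. f (T t x) = f (T t y)"
  shows "wave_coeff b (g k) (q k) (a k) x = wave_coeff b (g k) (q k) (a k) y"
proof -
  define w where "w k = wave b (g k) (q k) (a k)" for k
  define J where "J k = wave_coeff b (g k) (q k) (a k)" for k
  define D where "D k d = (1/2) ^ Suc k * ((w k (T d x) - w k x) - (w k (T d y) - w k y))" for k and d :: real
  have half: "summable (\<lambda>k. (1/2::real) ^ Suc k)"
    using power_half_series by (rule sums_summable)
  have summ: "summable (\<lambda>k. (1/2) ^ Suc k * w k z)" if "z \<in> X" for z
  proof (rule summable_comparison_test'[OF half])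
    have "0 \<le> w k z \<and> w k z \<le> 1" for k
      using wave_bounds[OF b g q that, of "a k"] a(2)[of k] by (simp add: w_def)
    then show "norm ((1/2) ^ Suc k * w k z) \<le> (1/2) ^ Suc k" for k
      by (simp add: abs_mult mult_left_le)
  qed
  have sums: "(\<lambda>k. (1/2) ^ Suc k * w k z) sums (f z - avg H z)" if "z \<in> X" for z
    using summable_sums[OF summ[OF that]] by (simp add: f_def w_def)
  have exp_w: "(\<lambda>d. w k (T d z) - w k z - J k z * d powr a k) \<in> O[at_right 0](\<lambda>d. d)" if "z \<in> X" for k z
    unfolding w_def J_def by (rule wave_expansion[OF b g that a(2,3)])
  \<comment> \<open>The factor 4 in \<open>M\<close> collects a bound with constant 2 from each of
    the two orbits.\<close>
  have "(1/2) ^ Suc k * (J k x - J k y) = 0"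
  proof (rule powr_series_coeffs_zero[where a = a and D = D and M = "\<lambda>k. 4 * (1/2) ^ Suc k"])
    show "strict_mono a" "\<And>k. a k \<le> 1" by (fact a)+
    show "summable (\<lambda>k. 4 * (1/2::real) ^ Suc k)" by (intro summable_mult half)
    fix k
    have "(\<lambda>d. (1/2) ^ Suc k * ((w k (T d x) - w k x - J k x * d powr a k)
        - (w k (T d y) - w k y - J k y * d powr a k))) \<in> O[at_right 0](\<lambda>d. d)"
      using sum_in_bigo(2)[OF exp_w[OF xy(1), of k] exp_w[OF xy(2), of k]] by simp
    then show "(\<lambda>d. D k d - (1/2) ^ Suc k * (J k x - J k y) * d powr a k) \<in> O[at_right 0](\<lambda>d. d)"
      by (simp add: D_def algebra_simps del: power_Suc)
    fix d :: real assume d: "0 < d" "d < 1"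
    have "0 < a k" using a(2)[of k] by linarith
    then have "\<bar>(w k (T d x) - w k x) - (w k (T d y) - w k y)\<bar> \<le> 4 * d powr a k"
      using wave_increment_le[OF b g[of k] q[of k] xy(1) _ a(3)[of k] d]
        wave_increment_le[OF b g[of k] q[of k] xy(2) _ a(3)[of k] d]
      unfolding w_def by linarith
    then have "(1/2) ^ Suc k * \<bar>(w k (T d x) - w k x) - (w k (T d y) - w k y)\<bar> \<le> (1/2) ^ Suc k * (4 * d powr a k)"
      by (intro mult_left_mono) auto
    then show "\<bar>D k d\<bar> \<le> 4 * (1/2) ^ Suc k * d powr a k"
      by (simp add: D_def abs_mult)
  next
    have "(\<Sum>k. D k d) = (avg H (T d y) - avg H y) - (avg H (T d x) - avg H x)" for d
    proof -
      have "(\<lambda>k. D k d) sums (((f (T d x) - avg H (T d x)) - (f x - avg H x))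
          - ((f (T d y) - avg H (T d y)) - (f y - avg H y)))"
        unfolding D_def right_diff_distrib by (intro sums_diff sums xy action_in)
      moreover have "f x = f y" using eq[of 0] xy by (simp add: action_zero)
      ultimately show ?thesis using eq[of d] by (simp add: sums_iff)
    qed
    moreover have "(\<lambda>d. avg H (T d z) - avg H z) \<in> O[at_right 0](\<lambda>d. d)" if "z \<in> X" for z
      using DERIV_imp_bigo_at_right[OF avg_has_derivative[OF H that]] that by (simp add: action_zero)
    ultimately show "(\<lambda>d. \<Sum>k. D k d) \<in> O[at_right 0](\<lambda>d. d)"
      using xy by (simp add: sum_in_bigo)
  qed
  then show ?thesis by (simp add: J_def)
qed

text \<open>A nonzero coefficient on one orbit forces the other orbit to be at the same level at the
  same time. So \<open>eq_or_locally_constant\<close> applies to \<open>avg (avg (g k))\<close>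
  along both orbits, and \<open>avg_determines\<close>, used twice, carries each alternative back to
  \<open>g k\<close>.\<close>

lemma eq_if_wave_coeffs_eq:
  assumes b: "b \<in> observables" "\<And>x. x \<in> X \<Longrightarrow> b x = 0 \<longleftrightarrow> x \<in> Fix X T"
    and g: "\<And>k. g k \<in> observables"
    and sep: "\<And>x y z. x \<in> X \<Longrightarrow> y \<in> X \<Longrightarrow> z \<in> X \<Longrightarrow> y \<noteq> x \<Longrightarrow> z \<noteq> x
      \<Longrightarrow> \<exists>k. g k x \<noteq> g k y \<and> g k x \<noteq> g k z"
    and xy: "x \<in> X" "y \<in> X" and nonfixed: "x \<notin> Fix X T"
    and eq: "\<And>k q t. q \<in> \<rat> \<inter> {0..1} \<Longrightarrow>
      \<exists>a. wave_coeff b (g k) q a (T t x) = wave_coeff b (g k) q a (T t y)"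
  shows "x = y"
proof (rule ccontr)
  assume "x \<noteq> y"
  obtain c where c: "T c x \<noteq> x" using nonfixed xy(1) by (auto simp: Fix_def)
  \<comment> \<open>The inequality with \<open>y\<close> refutes agreement of the two orbits, the
    one with \<open>T c x\<close> refutes constancy along the orbit of \<open>x\<close>.\<close>
  obtain k where k: "g k x \<noteq> g k y" "g k x \<noteq> g k (T c x)"
    using sep[of x y "T c x"] xy action_in c \<open>x \<noteq> y\<close> by metis
  note gk = g[of k] and Agk = avg_observable[OF g[of k]] and AAgk = avg_observable[OF avg_observable[OF g[of k]]]
  \<comment> \<open>Nonzero speed excludes a fixed point; the whole orbit then avoids the zeros of
    \<open>b\<close>.\<close>
  have zero_or_pos: "avg b (T t z) \<noteq> 0" if z: "z \<in> X" and "avg_rate (avg (g k)) (T t z) \<noteq> 0" for z t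
  proof -
    have "z \<notin> Fix X T"
    proof
      assume fixed: "z \<in> Fix X T"
      then have "(\<lambda>t. avg (avg (g k)) (T t z)) = (\<lambda>_. avg (avg (g k)) z)" by (simp add: Fix_def)
      then have "avg_rate (avg (g k)) (T t z) = 0"
        using avg_has_derivative[OF Agk z, of t] by (metis DERIV_const DERIV_unique)
      with that show False by simp
    qed
    then have "0 < b (T s (T t z))" for s
      using observables_bounds[OF b(1) action_in[OF action_in[OF z], of s t]] b(2)[of "T s (T t z)"]
        action_in z action_Fix_iff by (metis order_le_less)
    then show ?thesis using avg_pos[OF b(1) action_in[OF z, of t]] by simp
  qed
  have transfer: "avg (avg (g k)) (T t z') = avg (avg (g k)) (T t z)"
    if z: "z \<in> X" "z' \<in> X" and "avg (avg (g k)) (T t z) \<in> \<rat>"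
      and rate: "avg_rate (avg (g k)) (T t z) \<noteq> 0"
      and coeff: "\<And>q. q \<in> \<rat> \<inter> {0..1} \<Longrightarrow>
        \<exists>a. wave_coeff b (g k) q a (T t z) = wave_coeff b (g k) q a (T t z')" for z z' t
  proof -
    define q where "q = avg (avg (g k)) (T t z)"
    have "q \<in> \<rat> \<inter> {0..1}"
      using observables_bounds[OF AAgk action_in[OF z(1), of t]] that by (simp add: q_def)
    from coeff[OF this] obtain a where "wave_coeff b (g k) q a (T t z) = wave_coeff b (g k) q a (T t z')" ..
    moreover have "wave_coeff b (g k) q a (T t z) \<noteq> 0"
      using rate zero_or_pos[OF z(1) rate] by (simp add: wave_coeff_def q_def)
    ultimately show ?thesis by (auto simp: wave_coeff_def q_def split: if_splits)
  qed
  have rate_cont: "isCont (\<lambda>t. avg_rate (avg (g k)) (T t z)) t" if z: "z \<in> X" for z t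
  proof -
    have "continuous_on UNIV (\<lambda>t. avg_rate (avg (g k)) (T t z))"
      unfolding avg_rate_def action_add[OF z, symmetric]
      by (intro continuous_intros continuous_on_observable_action Agk AAgk) (use z in auto)
    then show ?thesis by (simp add: continuous_on_eq_continuous_at)
  qed
  have "(\<lambda>t. avg (avg (g k)) (T t x)) = (\<lambda>t. avg (avg (g k)) (T t y)) \<or>
      (\<forall>t. avg (avg (g k)) (T t x) = avg (avg (g k)) (T 0 x))"
    by (rule eq_or_locally_constant[OF avg_has_derivative[OF Agk xy(1)] avg_has_derivative[OF Agk xy(2)]
          rate_cont[OF xy(1)] rate_cont[OF xy(2)]])
      (use transfer xy eq in metis)+
  then show False
  proof
    assume "(\<lambda>t. avg (avg (g k)) (T t x)) = (\<lambda>t. avg (avg (g k)) (T t y))"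
    then have AA: "avg (avg (g k)) (T t x) = avg (avg (g k)) (T t y)" for t by (rule fun_cong)
    have "avg (g k) (T t x) = avg (g k) (T t y)" for t
      using AA xy by (intro avg_determines[OF Agk]) (simp_all add: action_in action_add[symmetric])
    then have "g k x = g k y" by (rule avg_determines[OF gk xy])
    with k show False by simp
  next
    assume "\<forall>t. avg (avg (g k)) (T t x) = avg (avg (g k)) (T 0 x)"
    \<comment> \<open>Constancy means that \<open>x\<close> and its shift \<open>T c x\<close> have
      the same averages along their orbits.\<close>
    then have AA: "avg (avg (g k)) (T t x) = avg (avg (g k)) (T s x)" for s t by metis
    have "avg (g k) (T t x) = avg (g k) (T t (T c x))" for t
      using AA xy by (intro avg_determines[OF Agk]) (simp_all add: action_in action_add[symmetric])
    then have "g k x = g k (T c x)" using xy by (intro avg_determines[OF gk]) (simp_all add: action_in)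
    with k show False by simp
  qed
qed

section \<open>Assembling the separating function\<close>

lemma ex_separating_observable:
  assumes H: "H \<in> observables" "inj_on H (Fix X T)"
  obtains f where "f \<in> observables"
    and "\<And>x y. x \<in> X \<Longrightarrow> y \<in> X \<Longrightarrow> (\<And>t. f (T t x) = f (T t y)) \<Longrightarrow> x = y"
proof -
  obtain b where b: "b \<in> observables" "\<And>x. x \<in> X \<Longrightarrow> b x = 0 \<longleftrightarrow> x \<in> Fix X T"
    using ex_observable_zero_iff_Fix by blast
  obtain g :: "nat \<Rightarrow> 'a \<Rightarrow> real" where g: "\<And>k. g k \<in> observables"
    and sep: "\<And>x y z. x \<in> X \<Longrightarrow> y \<in> X \<Longrightarrow> z \<in> X \<Longrightarrow> y \<noteq> x \<Longrightarrow> z \<noteq> x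
      \<Longrightarrow> \<exists>k. g k x \<noteq> g k y \<and> g k x \<noteq> g k z"
    using ex_separating_observables by metis
  define i where "i k = fst (prod_decode k)" for k
  \<comment> \<open>Clamping puts every level into [0, 1] and leaves the rationals already there
    unchanged, so each of them still occurs together with each \<open>g j\<close>.\<close>
  define q :: "nat \<Rightarrow> real" where
    "q k = max 0 (min 1 (of_rat (from_nat (snd (prod_decode k)))))" for k
  \<comment> \<open>Strictly increasing from \<open>a 0 = 1/2\<close> towards 1.\<close>
  define a :: "nat \<Rightarrow> real" where "a k = 1 - 1 / (real k + 2)" for k
  have q: "q k \<in> {0..1}" for k by (auto simp: q_def)
  have a: "strict_mono a" "1 / 2 \<le> a k" "a k \<le> 1" for k
    by (auto simp: a_def strict_mono_def field_simps)
  define f where "f x = avg H x + (\<Sum>k. (1/2) ^ Suc k * wave b (g (i k)) (q k) (a k) x)" for x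
  have wave: "wave b (g (i k)) (q k) (a k) \<in> observables" for k
    using wave_observable[OF b(1) g q] a(2)[of k] by simp
  have half: "summable (\<lambda>k. (1/2::real) ^ Suc k)"
    using power_half_series by (rule sums_summable)
  have term_le: "\<bar>(1/2) ^ Suc k * wave b (g (i k)) (q k) (a k) x\<bar> \<le> (1/2) ^ Suc k"
    and term_nonneg: "0 \<le> (1/2) ^ Suc k * wave b (g (i k)) (q k) (a k) x" if "x \<in> X" for k x
    using observables_bounds[OF wave that, of k] by (auto simp: abs_mult mult_left_le)
  have f_eqD: "x = y" if xy: "x \<in> X" "y \<in> X" and x: "x \<notin> Fix X T" and eq: "\<And>t. f (T t x) = f (T t y)" for x y
  proof (rule eq_if_wave_coeffs_eq[OF b g sep xy x])
    fix j t and r :: real assume r: "r \<in> \<rat> \<inter> {0..1}"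
    then obtain r' where r': "r = of_rat r'" by (auto elim: Rats_cases)
    define k where "k = prod_encode (j, to_nat r')"
    have k: "i k = j" "q k = r" using r by (simp_all add: i_def q_def k_def r')
    \<comment> \<open>Passing to \<open>T t x\<close> and \<open>T t y\<close> turns the comparison
      of coefficients at time 0 into one at time \<open>t\<close>.\<close>
    have "f (T s (T t x)) = f (T s (T t y))" for s
      using eq[of "s + t"] xy by (simp add: action_add)
    then have "wave_coeff b (g (i k)) (q k) (a k) (T t x) = wave_coeff b (g (i k)) (q k) (a k) (T t y)"
      unfolding f_def by (intro wave_coeffs_determined[OF b(1) H(1) g q a] action_in xy)
    then show "\<exists>a. wave_coeff b (g j) r a (T t x) = wave_coeff b (g j) r a (T t y)"
      unfolding k by blast
  qed
  show thesis
  proof (rule that[of "\<lambda>x. f x / 2"]) \<comment> \<open>halving keeps the values in \<open>[0, 1]\<close>\<close>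
    have "continuous_on X (\<lambda>x. (1/2) ^ Suc k * wave b (g (i k)) (q k) (a k) x)" for k
      using wave[of k] by (intro continuous_intros) (simp add: observables_def)
    then have "continuous_on X (\<lambda>x. \<Sum>k. (1/2) ^ Suc k * wave b (g (i k)) (q k) (a k) x)"
      using term_le half by (rule continuous_on_suminf)
    then have "continuous_on X (\<lambda>x. f x / 2)"
      unfolding f_def using avg_observable[OF H(1)]
      by (intro continuous_intros) (auto simp: observables_def)
    moreover have "f x / 2 \<in> {0..1}" if x: "x \<in> X" for x
    proof -
      have "summable (\<lambda>k. (1/2) ^ Suc k * wave b (g (i k)) (q k) (a k) x)"
        using term_le[OF x] by (intro summable_comparison_test'[OF half]) auto
      then have "0 \<le> (\<Sum>k. (1/2) ^ Suc k * wave b (g (i k)) (q k) (a k) x)"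
        "(\<Sum>k. (1/2) ^ Suc k * wave b (g (i k)) (q k) (a k) x) \<le> (\<Sum>k. (1/2) ^ Suc k)"
        using term_nonneg[OF x] term_le[OF x]
        by (auto intro!: suminf_nonneg suminf_le half simp: abs_le_iff)
      then show ?thesis
        using observables_bounds[OF avg_observable[OF H(1)] x] sums_unique[OF power_half_series]
        by (simp add: f_def)
    qed
    ultimately show "(\<lambda>x. f x / 2) \<in> observables" by (auto simp: observables_def)
    fix x y assume xy: "x \<in> X" "y \<in> X" and "\<And>t. f (T t x) / 2 = f (T t y) / 2"
    then have eq: "f (T t x) = f (T t y)" for t by simp
    show "x = y"
    proof (cases "x \<in> Fix X T \<and> y \<in> Fix X T")
      case True
      \<comment> \<open>On fixed points the weight \<open>avg b\<close> vanishes, so only the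
        average of \<open>H\<close> remains.\<close>
      have "f z = (1 - exp (-1)) * H z" if z: "z \<in> Fix X T" for z
      proof -
        have "z \<in> X" using z Fix_subset by blast
        then have "avg b z = 0" using b(2) avg_Fix[OF z, of b] z by simp
        then show ?thesis by (simp add: f_def wave_def avg_Fix[OF z, of H])
      qed
      with True eq[of 0] have "H x = H y" using xy by (simp add: action_zero)
      with True H(2) show ?thesis by (auto dest: inj_onD)
    next
      case False
      then show ?thesis using f_eqD[OF xy _ eq] f_eqD[OF xy(2,1) _ eq[symmetric]] by metis
    qed
  qed
qed

text \<open>The separating \<open>f\<close> need not be Lipschitz along orbits. One more average
  makes it so, and \<open>avg_determines\<close> preserves the separation.\<close>

lemma embeds_in_LR_if_Fix_embeds:
  assumes "embedding_map (top_of_set (Fix X T)) (top_of_set {0..1}) (h :: 'a \<Rightarrow> real)"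
  shows "equivariantly_embeds_in_LR X T"
proof -
  obtain H where "H \<in> observables" "inj_on H (Fix X T)"
    using ex_observable_inj_on_Fix[OF assms] by blast
  then obtain f where f: "f \<in> observables"
    and sep: "\<And>x y. x \<in> X \<Longrightarrow> y \<in> X \<Longrightarrow> (\<And>t. f (T t x) = f (T t y)) \<Longrightarrow> x = y"
    by (rule ex_separating_observable) blast
  show ?thesis
  proof (rule embeds_in_LR_if_separating[of "avg f"])
    fix x y assume xy: "x \<in> X" "y \<in> X" and eq: "\<And>t. avg f (T t x) = avg f (T t y)"
    have "f (T t x) = f (T t y)" for t
    proof (rule avg_determines[OF f action_in[OF xy(1)] action_in[OF xy(2)]])
      show "avg f (T s (T t x)) = avg f (T s (T t y))" for s
        using eq[of "s + t"] xy by (simp add: action_add)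
    qed
    then show "x = y" by (rule sep[OF xy])
  qed (simp_all add: f avg_observable avg_lipschitz)
qed

end

theorem theorem1p3:
  fixes X :: "'a::metric_space set" and T :: "real \<Rightarrow> 'a \<Rightarrow> 'a"
  assumes "flow X T"
  shows "equivariantly_embeds_in_LR X T \<longleftrightarrow>
    (\<exists>g :: 'a \<Rightarrow> real. embedding_map (top_of_set (Fix X T)) (top_of_set {0..1}) g)"
proof
  show "\<exists>g :: 'a \<Rightarrow> real. embedding_map (top_of_set (Fix X T)) (top_of_set {0..1}) g"
    if "equivariantly_embeds_in_LR X T"
    using flow.Fix_embeds_if_embeds_in_LR[OF assms that] .
  show "equivariantly_embeds_in_LR X T"
    if "\<exists>g :: 'a \<Rightarrow> real. embedding_map (top_of_set (Fix X T)) (top_of_set {0..1}) g"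
    using flow.embeds_in_LR_if_Fix_embeds[OF assms] that by blast
qed

end
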